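(* For every integer $d\ge 4$ there exists a bridgeless cubic graph $G$ whose defect $\operatorname{df}(G)$ equals $4$ and whose regular defect $\operatorname{rdf}(G)$ is at least $d$.
   Context: Graphs are finite and undirected; parallel edges and loops are permitted. A $3$-array of a cubic graph $G$ is a collection $\{M_1,M_2,M_3\}$ of three (not necessarily distinct) perfect matchings of $G$. An edge is uncovered by the $3$-array if it belongs to none of $M_1,M_2,M_3$. The defect $\operatorname{df}(G)$ of a bridgeless cubic graph $G$ is the minimum number of uncovered edges taken over all $3$-arrays of $G$. A $3$-array $\{M_1,M_2,M_3\}$ is regular if $M_1\cap M_2\cap M_3=\emptyset$. The regular defect $\operatorname{rdf}(G)$ is the minimum number of uncovered edges taken over all regular $3$-arrays of $G$. *)

theory Defs
  imports Main
begin

text \<open>Multigraphs: parallel edges are distinct edges with the same set of ends; a loop is an edge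
  whose set of ends is a singleton.\<close>

record ('v, 'e) multigraph =
  verts :: "'v set"
  edges :: "'e set"
  ends :: "'e \<Rightarrow> 'v set"

definition finite_multigraph :: "('v, 'e) multigraph \<Rightarrow> bool" where
  "finite_multigraph G \<longleftrightarrow> finite (verts G) \<and> finite (edges G) \<and>
     (\<forall>e\<in>edges G. ends G e \<subseteq> verts G \<and> (card (ends G e) = 1 \<or> card (ends G e) = 2))"

text \<open>The degree of a vertex in the spanning subgraph with edge set \<open>F\<close>; loops count twice.\<close>

definition degree_in :: "('v, 'e) multigraph \<Rightarrow> 'e set \<Rightarrow> 'v \<Rightarrow> nat" where
  "degree_in G F v = card {e\<in>F. v \<in> ends G e} + card {e\<in>F. ends G e = {v}}"

definition cubic :: "('v, 'e) multigraph \<Rightarrow> bool" where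
  "cubic G \<longleftrightarrow> (\<forall>v\<in>verts G. degree_in G (edges G) v = 3)"

definition adjacent_via :: "('v, 'e) multigraph \<Rightarrow> 'e set \<Rightarrow> ('v \<times> 'v) set" where
  "adjacent_via G F = {(u, v). \<exists>e\<in>F. ends G e = {u, v}}"

text \<open>An edge is a bridge if it separates its ends; in particular a loop is never a bridge.\<close>

definition bridge :: "('v, 'e) multigraph \<Rightarrow> 'e \<Rightarrow> bool" where
  "bridge G e \<longleftrightarrow> e \<in> edges G \<and>
     (\<exists>u v. ends G e = {u, v} \<and> (u, v) \<notin> (adjacent_via G (edges G - {e}))\<^sup>*)"

definition bridgeless :: "('v, 'e) multigraph \<Rightarrow> bool" where
  "bridgeless G \<longleftrightarrow> (\<forall>e\<in>edges G. \<not> bridge G e)"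

text \<open>A perfect matching is (the edge set of) a spanning 1-regular subgraph, so it contains no
  loops.\<close>

definition perfect_matching :: "('v, 'e) multigraph \<Rightarrow> 'e set \<Rightarrow> bool" where
  "perfect_matching G M \<longleftrightarrow> M \<subseteq> edges G \<and> (\<forall>v\<in>verts G. degree_in G M v = 1)"

definition three_array ::
  "('v, 'e) multigraph \<Rightarrow> 'e set \<Rightarrow> 'e set \<Rightarrow> 'e set \<Rightarrow> bool" where
  "three_array G M1 M2 M3 \<longleftrightarrow>
     perfect_matching G M1 \<and> perfect_matching G M2 \<and> perfect_matching G M3"

definition regular_three_array ::
  "('v, 'e) multigraph \<Rightarrow> 'e set \<Rightarrow> 'e set \<Rightarrow> 'e set \<Rightarrow> bool" where
  "regular_three_array G M1 M2 M3 \<longleftrightarrow> three_array G M1 M2 M3 \<and> M1 \<inter> M2 \<inter> M3 = {}"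

definition uncovered ::
  "('v, 'e) multigraph \<Rightarrow> 'e set \<Rightarrow> 'e set \<Rightarrow> 'e set \<Rightarrow> 'e set" where
  "uncovered G M1 M2 M3 = {e\<in>edges G. e \<notin> M1 \<and> e \<notin> M2 \<and> e \<notin> M3}"

definition defect :: "('v, 'e) multigraph \<Rightarrow> nat" where
  "defect G = Min {card (uncovered G M1 M2 M3) | M1 M2 M3. three_array G M1 M2 M3}"

text \<open>Every bridgeless cubic graph has a 3-array, so the minimum above exists for such graphs. That
  it always has a regular one is the Fan--Raspaud conjecture; the value below is therefore
  meaningful only together with the existence of a regular 3-array.\<close>

definition regular_defect :: "('v, 'e) multigraph \<Rightarrow> nat" where
  "regular_defect G =
     Min {card (uncovered G M1 M2 M3) | M1 M2 M3. regular_three_array G M1 M2 M3}"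

end

theory Submission imports Defs "HOL-Library.Countable" begin

text \<open>Deleting two adjacent vertices from the Petersen graph leaves a 4-pole with two incoming and two
  outgoing dangling edges, the former being left by one deleted vertex and the latter by the other.
  In every 3-edge-colouring of this 4-pole the two incoming edges have the same colour.
  Arrange \<open>d\<close> copies of it in a closed necklace together with a hub: two triangles joined by an
  edge \<open>h\<close>. The two edges entering a copy form a 3-edge-cut with \<open>h\<close>. If a 3-array covers them and
  all edges of the copy, then it induces a 3-edge-colouring, so the entering edges lie in the same
  matching, and by parity each of the three matchings contains \<open>h\<close>. Hence a regular 3-array leaves
  an edge at every copy uncovered. If \<open>h\<close> is allowed in all three matchings, only the four edges
  adjacent to \<open>h\<close> remain uncovered; four is optimal because the four edges adjacent to a triply
  covered edge are always uncovered. Since a bridge of a cubic graph lies in every perfect matching,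
  a regular 3-array also certifies that the necklace is bridgeless.\<close>

subsection \<open>Edge cuts and bridges\<close>

lemma ends_eq:
  assumes "finite_multigraph G" "e \<in> edges G" "u \<in> ends G e" "v \<in> ends G e" "u \<noteq> v"
  shows "ends G e = {u, v}"
  using assms by (auto simp: finite_multigraph_def card_1_singleton_iff card_2_iff)

definition cut :: "('v, 'e) multigraph \<Rightarrow> 'v set \<Rightarrow> 'e set" where
  "cut G S = {e\<in>edges G. ends G e \<inter> S \<noteq> {} \<and> \<not> ends G e \<subseteq> S}"

lemma sum_degree_in:
  assumes "finite F" "finite S"
  shows "(\<Sum>v\<in>S. degree_in G F v) = (\<Sum>e\<in>F. card (S \<inter> ends G e) + card {v\<in>S. ends G e = {v}})"
proof -
  have "degree_in G F v = (\<Sum>e\<in>F. of_bool (v \<in> ends G e) + of_bool (ends G e = {v}))" for v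
    using \<open>finite F\<close> by (simp add: degree_in_def sum.distrib of_bool_def sum.If_cases Int_def)
  then have "(\<Sum>v\<in>S. degree_in G F v)
      = (\<Sum>e\<in>F. \<Sum>v\<in>S. of_bool (v \<in> ends G e) + of_bool (ends G e = {v}))"
    by (simp add: sum.swap[of _ S])
  then show ?thesis
    using \<open>finite S\<close> by (simp add: sum.distrib of_bool_def sum.If_cases Int_def)
qed

lemma odd_incidences_iff:
  assumes "card X = 1 \<or> card X = 2"
  shows "odd (card (S \<inter> X) + card {v\<in>S. X = {v}}) \<longleftrightarrow> X \<inter> S \<noteq> {} \<and> \<not> X \<subseteq> S"
  using assms
proof
  assume "card X = 1"
  then obtain x where X: "X = {x}" by (auto simp: card_1_singleton_iff)
  have "{v\<in>S. X = {v}} = S \<inter> X" using X by auto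
  then show ?thesis using X by auto
next
  assume "card X = 2"
  then obtain x y where X: "X = {x, y}" "x \<noteq> y" by (auto simp: card_2_iff)
  then have "{v\<in>S. X = {v}} = {}" by auto
  moreover have "odd (card (S \<inter> X)) \<longleftrightarrow> X \<inter> S \<noteq> {} \<and> \<not> X \<subseteq> S"
    using X by (cases "x \<in> S"; cases "y \<in> S") simp_all
  ultimately show ?thesis by (simp only: card.empty add_0_right)
qed

lemma even_sum_degree_in_iff:
  assumes "finite_multigraph G" "F \<subseteq> edges G" "finite S"
  shows "even (\<Sum>v\<in>S. degree_in G F v) \<longleftrightarrow> even (card (cut G S \<inter> F))"
proof -
  have "finite F" using assms by (meson finite_multigraph_def finite_subset)
  have "odd (card (S \<inter> ends G e) + card {v\<in>S. ends G e = {v}}) \<longleftrightarrow> e \<in> cut G S"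
    if "e \<in> F" for e
  proof -
    have "e \<in> edges G" "card (ends G e) = 1 \<or> card (ends G e) = 2"
      using assms that by (auto simp: finite_multigraph_def)
    then show ?thesis by (simp only: odd_incidences_iff) (simp add: cut_def)
  qed
  then have "{e\<in>F. odd (card (S \<inter> ends G e) + card {v\<in>S. ends G e = {v}})} = cut G S \<inter> F"
    by blast
  then show ?thesis
    by (simp only: sum_degree_in[OF \<open>finite F\<close> \<open>finite S\<close>] even_sum_iff[OF \<open>finite F\<close>])
qed

lemma even_card_cut_inter_iff:
  assumes G: "finite_multigraph G" "F \<subseteq> edges G" and S: "S \<subseteq> verts G"
    and regular: "\<And>v. v \<in> verts G \<Longrightarrow> degree_in G F v = k" and "odd k"
  shows "even (card (cut G S \<inter> F)) \<longleftrightarrow> even (card S)"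
proof -
  have "finite S" using G(1) S by (meson finite_multigraph_def finite_subset)
  moreover have "(\<Sum>v\<in>S. degree_in G F v) = card S * k"
    using regular S by (simp add: subset_iff)
  ultimately show ?thesis
    using even_sum_degree_in_iff[OF G, of S] \<open>odd k\<close> by simp
qed

lemma cubic_matching_cut_parity:
  assumes "finite_multigraph G" "cubic G" "perfect_matching G M" "S \<subseteq> verts G"
  shows "even (card (cut G S \<inter> M)) \<longleftrightarrow> even (card (cut G S))"
proof -
  have "cut G S \<inter> edges G = cut G S" by (auto simp: cut_def)
  then show ?thesis
    using assms even_card_cut_inter_iff[of G M S 1] even_card_cut_inter_iff[of G "edges G" S 3]
    by (simp add: cubic_def perfect_matching_def)
qed

lemma three_edge_cut_matching:
  assumes "finite_multigraph G" "cubic G" "perfect_matching G M" "S \<subseteq> verts G"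
    and cut: "cut G S = {h, a, b}" "distinct [h, a, b]" and same: "a \<in> M \<longleftrightarrow> b \<in> M"
  shows "h \<in> M"
proof -
  have "odd (card ({h, a, b} \<inter> M))"
    using cubic_matching_cut_parity[OF assms(1-4)] cut by simp
  then show ?thesis using same cut(2) by (cases "h \<in> M"; cases "b \<in> M") simp_all
qed

lemma cut_reachable:
  assumes G: "finite_multigraph G" and F: "F \<subseteq> edges G"
  shows "cut G ((adjacent_via G F)\<^sup>* `` {u}) \<inter> F = {}" (is "cut G ?S \<inter> F = {}")
proof -
  have False if "e \<in> F" "e \<in> cut G ?S" for e
  proof -
    obtain p q where "p \<in> ends G e" "p \<in> ?S" "q \<in> ends G e" "q \<notin> ?S"
      using \<open>e \<in> cut G ?S\<close> by (auto simp: cut_def)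
    moreover from this have "ends G e = {p, q}"
      using G F \<open>e \<in> F\<close> by (metis ends_eq subsetD)
    then have "(p, q) \<in> adjacent_via G F"
      using \<open>e \<in> F\<close> by (auto simp: adjacent_via_def)
    ultimately show False by (auto intro: rtrancl_into_rtrancl)
  qed
  then show ?thesis by blast
qed

lemma bridge_in_perfect_matching:
  assumes G: "finite_multigraph G" "cubic G" and M: "perfect_matching G M" and "bridge G e"
  shows "e \<in> M"
proof -
  define R where "R = adjacent_via G (edges G - {e})"
  obtain u v where e: "e \<in> edges G" "ends G e = {u, v}" and uv: "(u, v) \<notin> R\<^sup>*"
    using \<open>bridge G e\<close> unfolding bridge_def R_def by blast
  have ends: "ends G f \<subseteq> verts G" if "f \<in> edges G" for f
    using G(1) that by (simp add: finite_multigraph_def)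
  then have "R `` verts G \<subseteq> verts G"
    by (auto simp: R_def adjacent_via_def)
  moreover have "u \<in> verts G" using ends[OF e(1)] e(2) by simp
  ultimately have S: "R\<^sup>* `` {u} \<subseteq> verts G"
    using Image_closed_trancl[of R "verts G"] by blast
  have "cut G (R\<^sup>* `` {u}) \<inter> (edges G - {e}) = {}"
    unfolding R_def using G(1) by (intro cut_reachable) auto
  then have "cut G (R\<^sup>* `` {u}) = {e}"
    using e uv by (auto simp: cut_def)
  then have "odd (card ({e} \<inter> M))"
    using cubic_matching_cut_parity[OF G M S] by simp
  then show ?thesis by (cases "e \<in> M") auto
qed

lemma bridgeless_if_regular_three_array:
  assumes "finite_multigraph G" "cubic G" "regular_three_array G M1 M2 M3"
  shows "bridgeless G"
  using assms bridge_in_perfect_matching[OF assms(1,2)]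
  unfolding bridgeless_def regular_three_array_def three_array_def by blast

lemma perfect_matching_edge_unique:
  assumes "finite_multigraph G" "perfect_matching G M" "v \<in> verts G"
    and "e \<in> M" "v \<in> ends G e" "f \<in> M" "v \<in> ends G f"
  shows "e = f"
proof -
  have "degree_in G M v = 1" "M \<subseteq> edges G"
    using assms by (auto simp: perfect_matching_def)
  then have "card {e\<in>M. v \<in> ends G e} \<le> Suc 0" "finite {e\<in>M. v \<in> ends G e}"
    using assms(1) by (auto simp: degree_in_def finite_multigraph_def intro: finite_subset)
  then show ?thesis
    using assms(4-7) by (simp add: card_le_Suc0_iff_eq)
qed

subsection \<open>Uncovered edges and colours\<close>

definition simple :: "('v, 'e) multigraph \<Rightarrow> bool" where
  "simple G \<longleftrightarrow> (\<forall>e\<in>edges G. card (ends G e) = 2) \<and> inj_on (ends G) (edges G)"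

lemma degree_in_loopless:
  assumes "\<And>e. e \<in> F \<Longrightarrow> card (ends G e) = 2"
  shows "degree_in G F v = card {e\<in>F. v \<in> ends G e}"
proof -
  have "{e\<in>F. ends G e = {v}} = {}" using assms by force
  then show ?thesis by (simp only: degree_in_def card.empty add_0_right)
qed

definition star :: "('v, 'e) multigraph \<Rightarrow> 'v \<Rightarrow> 'e set" where
  "star G v = {e\<in>edges G. v \<in> ends G e}"

lemma card_star:
  assumes "cubic G" "simple G" "v \<in> verts G"
  shows "card (star G v) = 3"
  using assms degree_in_loopless[of "edges G" G v] by (simp add: star_def cubic_def simple_def)

lemma star_Int_star:
  assumes G: "finite_multigraph G" "simple G"
    and e: "e \<in> edges G" "ends G e = {u, v}" "u \<noteq> v"
  shows "star G u \<inter> star G v = {e}"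
proof -
  have "f = e" if "f \<in> star G u \<inter> star G v" for f
  proof -
    have "ends G f = ends G e"
      using ends_eq[OF G(1), of f u v] that e by (simp add: star_def)
    then show ?thesis
      using G(2) that e(1) by (auto simp: simple_def star_def dest: inj_onD)
  qed
  then show ?thesis using e by (auto simp: star_def)
qed

lemma card_uncovered_irregular:
  assumes G: "finite_multigraph G" "cubic G" "simple G"
    and array: "three_array G M1 M2 M3" and e: "e \<in> M1 \<inter> M2 \<inter> M3"
  shows "4 \<le> card (uncovered G M1 M2 M3)"
proof -
  have M: "perfect_matching G M1" "perfect_matching G M2" "perfect_matching G M3"
    using array by (auto simp: three_array_def)
  then have "e \<in> edges G" using e by (auto simp: perfect_matching_def)
  then obtain u v where ends: "ends G e = {u, v}" "u \<noteq> v" and verts: "u \<in> verts G" "v \<in> verts G"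
    using G by (fastforce simp: simple_def finite_multigraph_def card_2_iff)
  have finite: "finite (edges G)" using G(1) by (simp add: finite_multigraph_def)
  let ?N = "star G u \<union> star G v - {e}"
  have inter: "star G u \<inter> star G v = {e}"
    by (rule star_Int_star[OF G(1,3) \<open>e \<in> edges G\<close> ends])
  then have "card (star G u \<union> star G v) = 5"
    using card_Un_Int[of "star G u" "star G v"] card_star[OF G(2,3)] verts finite
    by (simp add: star_def)
  then have "card ?N = 4"
    using inter by (subst card_Diff_singleton) auto
  moreover have "f \<in> edges G \<and> f \<notin> M" if "f \<in> ?N" "perfect_matching G M" "e \<in> M" for f M
    using perfect_matching_edge_unique[OF G(1) that(2) _ that(3)] that(1) ends verts
    by (auto simp: star_def)
  then have "?N \<subseteq> uncovered G M1 M2 M3"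
    using e M unfolding uncovered_def by blast
  moreover have "finite (uncovered G M1 M2 M3)" using finite by (simp add: uncovered_def)
  ultimately show ?thesis by (metis card_mono)
qed

lemma finite_card_uncovered:
  assumes "finite_multigraph G"
  shows "finite {card (uncovered G M1 M2 M3) | M1 M2 M3. P M1 M2 M3}"
proof (rule finite_subset)
  show "{card (uncovered G M1 M2 M3) | M1 M2 M3. P M1 M2 M3} \<subseteq> {..card (edges G)}"
    using assms by (auto simp: finite_multigraph_def uncovered_def intro!: card_mono)
qed simp

lemma defect_eqI:
  assumes "finite_multigraph G" "three_array G M1 M2 M3" "card (uncovered G M1 M2 M3) = k"
    and "\<And>N1 N2 N3. three_array G N1 N2 N3 \<Longrightarrow> k \<le> card (uncovered G N1 N2 N3)"
  shows "defect G = k"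
  unfolding defect_def
  by (rule Min_eqI[OF finite_card_uncovered[OF assms(1)]]) (use assms(2-4) in blast)+

lemma le_regular_defectI:
  assumes "finite_multigraph G" "regular_three_array G M1 M2 M3"
    and "\<And>N1 N2 N3. regular_three_array G N1 N2 N3 \<Longrightarrow> k \<le> card (uncovered G N1 N2 N3)"
  shows "k \<le> regular_defect G"
  unfolding regular_defect_def
  by (subst Min_ge_iff[OF finite_card_uncovered[OF assms(1)]]) (use assms(2,3) in blast)+

definition colour :: "'e set \<Rightarrow> 'e set \<Rightarrow> 'e \<Rightarrow> nat" where
  "colour M1 M2 e = (if e \<in> M1 then 0 else if e \<in> M2 then 1 else 2)"

lemma colour_less_3: "colour M1 M2 e < 3"
  by (simp add: colour_def)

lemma colour_adjacent_neq:
  assumes G: "finite_multigraph G" and array: "three_array G M1 M2 M3"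
    and v: "v \<in> verts G" "v \<in> ends G e" "v \<in> ends G f"
    and "e \<noteq> f" "{e, f} \<subseteq> M1 \<union> M2 \<union> M3"
  shows "colour M1 M2 e \<noteq> colour M1 M2 f"
proof -
  have "\<not> {e, f} \<subseteq> M" if "M \<in> {M1, M2, M3}" for M
    using perfect_matching_edge_unique[OF G _ v(1) _ v(2) _ v(3)] array that \<open>e \<noteq> f\<close>
    by (auto simp: three_array_def)
  then show ?thesis
    using assms(7) by (auto simp: colour_def)
qed

definition covered_once :: "'e set \<Rightarrow> 'e set \<Rightarrow> 'e set \<Rightarrow> 'e \<Rightarrow> bool" where
  "covered_once M1 M2 M3 e \<longleftrightarrow> e \<in> M1 \<union> M2 \<union> M3 \<and>
     e \<notin> M1 \<inter> M2 \<and> e \<notin> M1 \<inter> M3 \<and> e \<notin> M2 \<inter> M3"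

lemma covered_once_same_colour:
  assumes "covered_once M1 M2 M3 e" "covered_once M1 M2 M3 f" "colour M1 M2 e = colour M1 M2 f"
    and "M \<in> {M1, M2, M3}"
  shows "e \<in> M \<longleftrightarrow> f \<in> M"
  using assms by (auto simp: covered_once_def colour_def split: if_splits)

lemma covered_once_at_covered_vertex:
  assumes G: "finite_multigraph G" and array: "three_array G M1 M2 M3"
    and v: "v \<in> verts G" "v \<in> ends G e" "v \<in> ends G f" "v \<in> ends G g"
    and edges: "distinct [e, f, g]" "{e, f, g} \<subseteq> M1 \<union> M2 \<union> M3"
  shows "covered_once M1 M2 M3 e"
proof -
  have one: "\<not> {e, f} \<subseteq> M" "\<not> {e, g} \<subseteq> M" "\<not> {f, g} \<subseteq> M" if "M \<in> {M1, M2, M3}" for M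
    using perfect_matching_edge_unique[OF G _ v(1)] v array that edges(1)
    by (auto simp: three_array_def)
  have False
    if "e \<in> M" "e \<in> N" "{M, N, K} \<subseteq> {M1, M2, M3}" "{e, f, g} \<subseteq> M \<union> N \<union> K" for M N K
  proof -
    have "f \<notin> M" "g \<notin> M" "f \<notin> N" "g \<notin> N"
      using one[of M] one[of N] that(1-3) by auto
    then have "{f, g} \<subseteq> K" using that(4) by auto
    then show False using one[of K] that(3) by auto
  qed
  from this[of M1 M2 M3] this[of M1 M3 M2] this[of M2 M3 M1] show ?thesis
    using edges(2) by (auto simp: covered_once_def Un_ac)
qed

subsection \<open>Relabelling\<close>

definition relabel ::
  "('v \<Rightarrow> 'w) \<Rightarrow> ('e \<Rightarrow> 'f) \<Rightarrow> ('v, 'e) multigraph \<Rightarrow> ('w, 'f) multigraph" where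
  "relabel f g G = \<lparr>verts = f ` verts G, edges = g ` edges G, ends = \<lambda>e. f ` ends G (inv g e)\<rparr>"

context
  fixes f :: "'v \<Rightarrow> 'w" and g :: "'e \<Rightarrow> 'f"
  assumes inj: "inj f" "inj g"
begin

lemma ends_relabel: "ends (relabel f g G) (g e) = f ` ends G e"
  by (simp add: relabel_def inj)

lemma degree_in_relabel: "degree_in (relabel f g G) (g ` F) (f v) = degree_in G F v"
proof -
  have "{e\<in>g ` F. f v \<in> ends (relabel f g G) e} = g ` {e\<in>F. v \<in> ends G e}"
    "{e\<in>g ` F. ends (relabel f g G) e = {f v}} = g ` {e\<in>F. ends G e = {v}}"
    using inj(1) inj_image_eq_iff[OF inj(1), of _ "{v}"]
    by (auto simp: ends_relabel inj_image_mem_iff)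
  then show ?thesis
    by (simp add: degree_in_def card_image inj_on_subset[OF inj(2)])
qed

lemma finite_multigraph_relabel: "finite_multigraph (relabel f g G) \<longleftrightarrow> finite_multigraph G"
  using inj by (simp add: finite_multigraph_def relabel_def finite_image_iff inj_on_subset
      inj_image_subset_iff card_image)

lemma cubic_relabel: "cubic (relabel f g G) \<longleftrightarrow> cubic G"
  using degree_in_relabel[of G "edges G"] by (simp add: cubic_def relabel_def)

lemma perfect_matching_relabel:
  "perfect_matching (relabel f g G) N \<longleftrightarrow> (\<exists>M. N = g ` M \<and> perfect_matching G M)"
proof -
  have "N \<subseteq> g ` edges G \<longleftrightarrow> (\<exists>M. N = g ` M \<and> M \<subseteq> edges G)"
    by (auto simp: subset_image_iff)
  moreover have "perfect_matching (relabel f g G) (g ` M) \<longleftrightarrow> perfect_matching G M" for M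
    using degree_in_relabel[of G M] inj(2)
    by (simp add: perfect_matching_def relabel_def inj_image_subset_iff)
  moreover have "N \<subseteq> g ` edges G" if "perfect_matching (relabel f g G) N"
    using that by (simp add: perfect_matching_def relabel_def)
  ultimately show ?thesis by (metis perfect_matching_def)
qed

lemma three_array_relabel:
  "three_array (relabel f g G) N1 N2 N3 \<longleftrightarrow>
     (\<exists>M1 M2 M3. N1 = g ` M1 \<and> N2 = g ` M2 \<and> N3 = g ` M3 \<and> three_array G M1 M2 M3)"
  by (auto simp: three_array_def perfect_matching_relabel)

lemma regular_three_array_relabel:
  "regular_three_array (relabel f g G) N1 N2 N3 \<longleftrightarrow>
     (\<exists>M1 M2 M3. N1 = g ` M1 \<and> N2 = g ` M2 \<and> N3 = g ` M3 \<and> regular_three_array G M1 M2 M3)"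
proof -
  have "g ` M1 \<inter> g ` M2 \<inter> g ` M3 = g ` (M1 \<inter> M2 \<inter> M3)" for M1 M2 M3
    by (simp add: image_Int[OF inj(2)])
  then have "M1 \<inter> M2 \<inter> M3 = {} \<longleftrightarrow> g ` M1 \<inter> g ` M2 \<inter> g ` M3 = {}" for M1 M2 M3
    by (simp only: image_is_empty)
  then show ?thesis
    unfolding regular_three_array_def three_array_relabel by (simp only:) metis
qed

lemma card_uncovered_relabel:
  "card (uncovered (relabel f g G) (g ` M1) (g ` M2) (g ` M3)) = card (uncovered G M1 M2 M3)"
proof -
  have "uncovered (relabel f g G) (g ` M1) (g ` M2) (g ` M3) = g ` uncovered G M1 M2 M3"
    using inj(2) by (fastforce simp: uncovered_def relabel_def dest: injD)
  then show ?thesis by (simp add: card_image inj_on_subset[OF inj(2)])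
qed

lemma defect_relabel: "defect (relabel f g G) = defect G"
  unfolding defect_def three_array_relabel
  by (rule arg_cong[of _ _ Min], intro Collect_cong) (metis card_uncovered_relabel)

lemma regular_defect_relabel: "regular_defect (relabel f g G) = regular_defect G"
  unfolding regular_defect_def regular_three_array_relabel
  by (rule arg_cong[of _ _ Min], intro Collect_cong) (metis card_uncovered_relabel)

end

subsection \<open>Necklaces of 4-poles\<close>

text \<open>The incoming dangling edges of a 4-pole are attached to its vertices \<open>0, 1\<close>, the outgoing ones
  to \<open>2, 3\<close>. An edge is the pair of its ends, the smaller one first.\<close>

definition four_pole :: "nat set \<Rightarrow> (nat \<times> nat) set \<Rightarrow> bool" where
  "four_pole V E \<longleftrightarrow> finite V \<and> {..<4} \<subseteq> V \<and> (\<forall>(a, b)\<in>E. a \<in> V \<and> b \<in> V \<and> a < b)"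

lemma finite_four_pole_edges: "four_pole V E \<Longrightarrow> finite E"
  by (rule finite_subset[of _ "V \<times> V"]) (auto simp: four_pole_def)

type_synonym necklace_edge = "(nat \<times> nat) \<times> nat \<times> nat"

definition bead_edge :: "nat \<Rightarrow> nat \<times> nat \<Rightarrow> necklace_edge" where
  "bead_edge i e = ((i, fst e), (i, snd e))"

definition link :: "nat \<Rightarrow> nat \<Rightarrow> nat \<Rightarrow> necklace_edge" where
  "link n i l = ((if i = 0 then n else i - 1, l + 2), (i, l))"

definition necklace_edges ::
  "nat \<Rightarrow> (nat \<Rightarrow> (nat \<times> nat) set) \<Rightarrow> nat set \<Rightarrow> necklace_edge set" where
  "necklace_edges n F L = (\<Union>i\<le>n. bead_edge i ` F i \<union> link n i ` L)"

definition necklace :: "nat \<Rightarrow> (nat \<Rightarrow> nat set) \<Rightarrow> (nat \<Rightarrow> (nat \<times> nat) set) \<Rightarrow>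
    (nat \<times> nat, necklace_edge) multigraph" where
  "necklace n V E = \<lparr>verts = Sigma {..n} V, edges = necklace_edges n E {0, 1},
     ends = \<lambda>(u, v). {u, v}\<rparr>"

lemma necklace_edges_cases:
  assumes "e \<in> necklace_edges n F L"
  obtains i a b where "e = bead_edge i (a, b)" "i \<le> n" "(a, b) \<in> F i"
    | i l where "e = link n i l" "i \<le> n" "l \<in> L"
  using assms by (auto simp: necklace_edges_def)

lemma bead_edge_eq_iff: "bead_edge i e = bead_edge j f \<longleftrightarrow> i = j \<and> e = f"
  by (auto simp: bead_edge_def prod_eq_iff)

lemma link_eq_iff: "link n i l = link n j k \<longleftrightarrow> i = j \<and> l = k"
  by (auto simp: link_def)

lemma bead_edge_neq_link: "0 < n \<Longrightarrow> bead_edge i e \<noteq> link n j l"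
  by (auto simp: bead_edge_def link_def split: if_splits)

lemmas necklace_edge_eq_iffs =
  bead_edge_eq_iff link_eq_iff bead_edge_neq_link bead_edge_neq_link[symmetric]

lemma bead_edge_mem_iff:
  assumes "0 < n"
  shows "bead_edge i e \<in> necklace_edges n F L \<longleftrightarrow> i \<le> n \<and> e \<in> F i"
  using assms by (auto simp: necklace_edges_def necklace_edge_eq_iffs)

lemma link_mem_iff:
  assumes "0 < n"
  shows "link n i l \<in> necklace_edges n F L \<longleftrightarrow> i \<le> n \<and> l \<in> L"
  using assms by (auto simp: necklace_edges_def necklace_edge_eq_iffs)

lemma necklace_edges_Int:
  assumes "0 < n"
  shows "necklace_edges n F L \<inter> necklace_edges n F' L' = necklace_edges n (\<lambda>i. F i \<inter> F' i) (L \<inter> L')"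
  using assms by (auto simp: necklace_edges_def necklace_edge_eq_iffs)

lemma necklace_edges_Diff:
  assumes "0 < n"
  shows "necklace_edges n F L - necklace_edges n F' L' = necklace_edges n (\<lambda>i. F i - F' i) (L - L')"
  using assms by (auto simp: necklace_edges_def necklace_edge_eq_iffs image_iff)

lemma necklace_edges_mono:
  "(\<And>i. i \<le> n \<Longrightarrow> F i \<subseteq> F' i) \<Longrightarrow> L \<subseteq> L' \<Longrightarrow> necklace_edges n F L \<subseteq> necklace_edges n F' L'"
  by (fastforce simp: necklace_edges_def)

lemma edges_necklace: "edges (necklace n V E) = necklace_edges n E {0, 1}"
  by (simp add: necklace_def)

lemma ends_necklace: "ends (necklace n V E) e = {fst e, snd e}"
  by (simp add: necklace_def case_prod_beta)

lemma card_ends_necklace: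
  assumes "\<And>i. four_pole (V i) (E i)" "e \<in> edges (necklace n V E)"
  shows "card (ends (necklace n V E) e) = 2"
  using assms(2) unfolding edges_necklace
proof (cases rule: necklace_edges_cases)
  case (1 i a b)
  then show ?thesis
    using assms(1)[of i] by (auto simp: ends_necklace bead_edge_def four_pole_def)
next
  case (2 i l)
  then show ?thesis by (simp add: ends_necklace link_def)
qed

lemma ends_necklace_subset_verts:
  assumes "\<And>i. four_pole (V i) (E i)" "e \<in> edges (necklace n V E)"
  shows "ends (necklace n V E) e \<subseteq> verts (necklace n V E)"
  using assms(2) unfolding edges_necklace
proof (cases rule: necklace_edges_cases)
  case (1 i a b)
  then show ?thesis
    using assms(1)[of i] by (auto simp: necklace_def bead_edge_def four_pole_def)
next
  case (2 i l)
  then have "l \<in> V i" "l + 2 \<in> V (if i = 0 then n else i - 1)"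
    using assms(1) by (fastforce simp: four_pole_def)+
  then show ?thesis using 2 by (auto simp: necklace_def link_def)
qed

lemma finite_multigraph_necklace:
  assumes "\<And>i. four_pole (V i) (E i)"
  shows "finite_multigraph (necklace n V E)"
proof -
  have "finite (verts (necklace n V E))" "finite (edges (necklace n V E))"
    using assms finite_four_pole_edges[OF assms]
    by (auto simp: necklace_def necklace_edges_def four_pole_def)
  then show ?thesis
    using ends_necklace_subset_verts[OF assms] card_ends_necklace[OF assms]
    by (simp add: finite_multigraph_def)
qed

lemma simple_necklace:
  assumes "0 < n" "\<And>i. four_pole (V i) (E i)"
  shows "simple (necklace n V E)"
proof -
  have increasing: "a < b" if "(a, b) \<in> E i" for i a b
    using assms(2)[of i] that by (auto simp: four_pole_def)
  have sources: "fst e = fst f" if "e \<in> necklace_edges n E {0, 1}" "f \<in> necklace_edges n E {0, 1}"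
    "{fst e, snd e} = {fst f, snd f}" for e f
  proof (rule ccontr)
    assume "fst e \<noteq> fst f"
    then have "fst e = snd f" "snd e = fst f" using that(3) by (auto simp: doubleton_eq_iff)
    then show False
      using that(1,2) \<open>0 < n\<close>
      by (auto elim!: necklace_edges_cases simp: bead_edge_def link_def split: if_splits
          dest!: increasing)
  qed
  have "inj_on (ends (necklace n V E)) (edges (necklace n V E))"
    using sources by (fastforce simp: necklace_def inj_on_def doubleton_eq_iff)
  then show ?thesis
    using card_ends_necklace[OF assms(2)] by (simp add: simple_def)
qed

definition bead_degree :: "(nat \<times> nat) set \<Rightarrow> nat set \<Rightarrow> nat \<Rightarrow> nat" where
  "bead_degree F L v =
     card {e\<in>F. v = fst e \<or> v = snd e} + card {l\<in>L. v = l} + card {l\<in>L. v = l + 2}"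

lemma necklace_edges_at_vertex:
  assumes "0 < n" "i \<le> n"
  shows "{e\<in>necklace_edges n F L. (i, v) \<in> {fst e, snd e}} =
    bead_edge i ` {e\<in>F i. v = fst e \<or> v = snd e} \<union> link n i ` {l\<in>L. v = l}
    \<union> link n (if i = n then 0 else i + 1) ` {l\<in>L. v = l + 2}" (is "?D = ?B \<union> ?I \<union> ?O")
proof
  show "?D \<subseteq> ?B \<union> ?I \<union> ?O"
  proof
    fix e assume "e \<in> ?D"
    then have "e \<in> necklace_edges n F L" and v: "(i, v) \<in> {fst e, snd e}"
      by simp_all
    from this(1) show "e \<in> ?B \<union> ?I \<union> ?O"
    proof (cases rule: necklace_edges_cases)
      case (1 j a b)
      then have "i = j" "v = a \<or> v = b" using v by (auto simp: bead_edge_def)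
      then show ?thesis using 1 by (intro UnI1 image_eqI[of _ _ "(a, b)"]) auto
    next
      case (2 j l)
      then consider "j = i" "v = l" | "j = (if i = n then 0 else i + 1)" "v = l + 2"
        using v by (auto simp: link_def split: if_splits)
      then show ?thesis using 2 by cases auto
    qed
  qed
  show "?B \<union> ?I \<union> ?O \<subseteq> ?D"
    using assms by (auto simp: bead_edge_mem_iff link_mem_iff) (auto simp: bead_edge_def link_def)
qed

lemma degree_in_necklace:
  assumes "0 < n" and poles: "\<And>i. four_pole (V i) (E i)"
    and F: "\<And>i. F i \<subseteq> E i" and L: "L \<subseteq> {0, 1}" and "i \<le> n"
  shows "degree_in (necklace n V E) (necklace_edges n F L) (i, v) = bead_degree (F i) L v"
proof -
  let ?B = "bead_edge i ` {e\<in>F i. v = fst e \<or> v = snd e}"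
    and ?I = "link n i ` {l\<in>L. v = l}"
    and ?O = "link n (if i = n then 0 else i + 1) ` {l\<in>L. v = l + 2}"
  have "necklace_edges n F L \<subseteq> edges (necklace n V E)"
    unfolding edges_necklace by (rule necklace_edges_mono[OF F L])
  then have "degree_in (necklace n V E) (necklace_edges n F L) (i, v)
      = card {e\<in>necklace_edges n F L. (i, v) \<in> {fst e, snd e}}"
    using card_ends_necklace[OF poles]
    by (subst degree_in_loopless) (auto simp: ends_necklace)
  also have "\<dots> = card (?B \<union> ?I \<union> ?O)"
    by (simp only: necklace_edges_at_vertex[OF \<open>0 < n\<close> \<open>i \<le> n\<close>])
  also have "\<dots> = card ?B + card ?I + card ?O"
  proof -
    have "finite (F i)" "finite L"
      using finite_subset[OF F finite_four_pole_edges[OF poles]] finite_subset[OF L] by auto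
    moreover have "?B \<inter> ?I = {}" "(?B \<union> ?I) \<inter> ?O = {}"
      using \<open>0 < n\<close> by (auto simp: necklace_edge_eq_iffs)
    ultimately show ?thesis by (simp add: card_Un_disjoint)
  qed
  also have "\<dots> = bead_degree (F i) L v"
    by (simp add: bead_degree_def card_image inj_on_def necklace_edge_eq_iffs)
  finally show ?thesis .
qed

lemma cubic_necklace:
  assumes "0 < n" "\<And>i. four_pole (V i) (E i)"
    and "\<And>i v. v \<in> V i \<Longrightarrow> bead_degree (E i) {0, 1} v = 3"
  shows "cubic (necklace n V E)"
  using assms(3) degree_in_necklace[OF assms(1,2), where F = E and L = "{0, 1}"]
  by (auto simp: cubic_def necklace_def)

lemma perfect_matching_necklace:
  assumes "0 < n" "\<And>i. four_pole (V i) (E i)" "\<And>i. F i \<subseteq> E i" "L \<subseteq> {0, 1}"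
    and "\<And>i v. v \<in> V i \<Longrightarrow> bead_degree (F i) L v = 1"
  shows "perfect_matching (necklace n V E) (necklace_edges n F L)"
  using assms(5) degree_in_necklace[OF assms(1-4)] necklace_edges_mono[OF assms(3,4)]
  by (auto simp: perfect_matching_def necklace_def)

subsection \<open>The Petersen 4-pole and the ring\<close>

definition hub_edges :: "(nat \<times> nat) set" where
  "hub_edges = {(0, 1), (0, 4), (1, 4), (4, 5), (2, 5), (3, 5), (2, 3)}"

text \<open>The Petersen graph without two adjacent vertices \<open>s, t\<close>: the remaining neighbours of \<open>s\<close> are
  \<open>0, 1\<close>, those of \<open>t\<close> are \<open>2, 3\<close>.\<close>

definition petersen_edges :: "(nat \<times> nat) set" where
  "petersen_edges =
     {(0, 4), (0, 5), (1, 6), (1, 7), (4, 7), (5, 6), (2, 4), (3, 5), (2, 6), (3, 7)}"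

text \<open>Here \<open>x\<close> and \<open>y\<close> are the colours of the incoming edges; the outgoing edges need not be
  coloured.\<close>

definition petersen_colouring :: "nat \<Rightarrow> nat \<Rightarrow> (nat \<times> nat \<Rightarrow> nat) \<Rightarrow> bool" where
  "petersen_colouring x y c \<longleftrightarrow> x < 3 \<and> y < 3 \<and> (\<forall>e. c e < 3) \<and>
     (\<forall>e\<in>petersen_edges. (fst e = 0 \<longrightarrow> c e \<noteq> x) \<and> (fst e = 1 \<longrightarrow> c e \<noteq> y)) \<and>
     (\<forall>e\<in>petersen_edges. \<forall>f\<in>petersen_edges.
        e \<noteq> f \<longrightarrow> {fst e, snd e} \<inter> {fst f, snd f} \<noteq> {} \<longrightarrow> c e \<noteq> c f)"

lemma petersen_colouring_vertices:
  assumes "petersen_colouring x y c"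
  shows "distinct [x, c (0, 4), c (0, 5)]" "distinct [y, c (1, 6), c (1, 7)]"
    "c (2, 4) \<noteq> c (2, 6)" "c (3, 5) \<noteq> c (3, 7)"
    "distinct [c (0, 4), c (4, 7), c (2, 4)]" "distinct [c (0, 5), c (5, 6), c (3, 5)]"
    "distinct [c (1, 6), c (5, 6), c (2, 6)]" "distinct [c (1, 7), c (4, 7), c (3, 7)]"
  using assms by (auto simp: petersen_colouring_def petersen_edges_def)

definition reflect :: "nat \<Rightarrow> nat" where
  "reflect v = (if v < 2 then v else if even v then v + 1 else v - 1)"

lemma petersen_colouring_reflect:
  "petersen_colouring x y c \<Longrightarrow> petersen_colouring x y (\<lambda>e. c (map_prod reflect reflect e))"
  by (simp add: petersen_colouring_def petersen_edges_def reflect_def)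

lemma petersen_colouring_edge_04_neq:
  assumes colouring: "petersen_colouring x y c" and "x \<noteq> y"
  shows "c (0, 4) \<noteq> y"
proof
  assume edge_04: "c (0, 4) = y"
  define z where "z = c (0, 5)"
  have distinct: "distinct [x, y, z]"
    using petersen_colouring_vertices(1)[OF colouring] \<open>x \<noteq> y\<close> edge_04 by (auto simp: z_def)
  have third: "c e = z" if "c e \<noteq> x" "c e \<noteq> y" for e
  proof -
    have "c e < 3" "x < 3" "y < 3" "z < 3"
      using colouring unfolding petersen_colouring_def z_def by blast+
    then show ?thesis using distinct that by simp
  qed
  note vertices = petersen_colouring_vertices[OF colouring, folded z_def]
  have "c (1, 6) = x \<or> c (1, 6) = z"
    using third vertices by auto
  then have "c (2, 4) = c (2, 6)"
  proof
    assume "c (1, 6) = x"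
    then have "c (5, 6) = y" "c (4, 7) = x"
      using third vertices edge_04 distinct by (metis distinct_length_2_or_more)+
    then show ?thesis
      using third vertices edge_04 \<open>c (1, 6) = x\<close> by (metis distinct_length_2_or_more)
  next
    assume "c (1, 6) = z"
    then have "c (1, 7) = x"
      using third vertices by (metis distinct_length_2_or_more)
    then have "c (4, 7) = z" "c (2, 4) = x" "c (3, 7) = y"
      using third vertices edge_04 by (metis distinct_length_2_or_more)+
    then have "c (3, 5) = x" "c (5, 6) = y" "c (2, 6) = x"
      using third vertices \<open>c (1, 6) = z\<close> by (metis distinct_length_2_or_more)+
    with \<open>c (2, 4) = x\<close> show ?thesis by simp
  qed
  with vertices show False by simp
qed

lemma petersen_colouring_inputs_eq:
  assumes colouring: "petersen_colouring x y c"
  shows "x = y"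
proof (rule ccontr)
  assume "x \<noteq> y"
  then have "c (0, 4) \<noteq> y"
    using petersen_colouring_edge_04_neq[OF colouring] by simp
  moreover have "c (0, 5) \<noteq> y"
    using petersen_colouring_edge_04_neq[OF petersen_colouring_reflect[OF colouring] \<open>x \<noteq> y\<close>]
    by (simp add: reflect_def)
  ultimately have "distinct [x, y, c (0, 4), c (0, 5)]" "{x, y, c (0, 4), c (0, 5)} \<subseteq> {..<3}"
    using petersen_colouring_vertices(1)[OF colouring] colouring \<open>x \<noteq> y\<close>
    by (auto simp: petersen_colouring_def)
  then show False
    using card_mono[of "{..<3}" "{x, y, c (0, 4), c (0, 5)}"] by simp
qed

definition ring_edges ::
  "nat \<Rightarrow> (nat \<times> nat) set \<Rightarrow> (nat \<times> nat) set \<Rightarrow> nat set \<Rightarrow> necklace_edge set" where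
  "ring_edges n H P L = necklace_edges n (\<lambda>i. if i = 0 then H else P) L"

definition ring :: "nat \<Rightarrow> (nat \<times> nat, necklace_edge) multigraph" where
  "ring n = necklace n (\<lambda>i. if i = 0 then {..<6} else {..<8})
     (\<lambda>i. if i = 0 then hub_edges else petersen_edges)"

lemma verts_ring: "(i, j) \<in> verts (ring n) \<longleftrightarrow> i \<le> n \<and> j < (if i = 0 then 6 else 8)"
  by (auto simp: ring_def necklace_def)

lemma edges_ring: "edges (ring n) = ring_edges n hub_edges petersen_edges {0, 1}"
  by (simp add: ring_def edges_necklace ring_edges_def)

lemma ends_ring: "ends (ring n) e = {fst e, snd e}"
  by (simp add: ring_def ends_necklace)

lemma four_pole_hub_petersen:
  "four_pole (if i = 0 then {..<6} else {..<8}) (if i = 0 then hub_edges else petersen_edges)"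
  by (auto simp: four_pole_def hub_edges_def petersen_edges_def)

lemma finite_multigraph_ring: "finite_multigraph (ring n)"
  unfolding ring_def by (rule finite_multigraph_necklace[OF four_pole_hub_petersen])

lemma simple_ring: "0 < n \<Longrightarrow> simple (ring n)"
  unfolding ring_def by (rule simple_necklace[OF _ four_pole_hub_petersen])

lemma cubic_ring:
  assumes "0 < n"
  shows "cubic (ring n)"
proof -
  have "\<forall>v\<in>{..<6}. bead_degree hub_edges {0, 1} v = 3"
    "\<forall>v\<in>{..<8}. bead_degree petersen_edges {0, 1} v = 3"
    by code_simp+
  then show ?thesis
    unfolding ring_def
    by (intro cubic_necklace[OF assms four_pole_hub_petersen]) (auto split: if_splits)
qed

lemma perfect_matching_ring:
  assumes "0 < n" "H \<subseteq> hub_edges" "P \<subseteq> petersen_edges" "L \<subseteq> {0, 1}"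
    and "\<forall>v\<in>{..<6}. bead_degree H L v = 1" "\<forall>v\<in>{..<8}. bead_degree P L v = 1"
  shows "perfect_matching (ring n) (ring_edges n H P L)"
  unfolding ring_def ring_edges_def
  by (intro perfect_matching_necklace[OF assms(1) four_pole_hub_petersen])
    (use assms in \<open>auto split: if_splits\<close>)

definition unlinked_matching :: "nat \<Rightarrow> necklace_edge set" where
  "unlinked_matching n = ring_edges n {(0, 1), (4, 5), (2, 3)} {(0, 4), (1, 7), (3, 5), (2, 6)} {}"

definition reflected_unlinked_matching :: "nat \<Rightarrow> necklace_edge set" where
  "reflected_unlinked_matching n =
     ring_edges n {(0, 1), (4, 5), (2, 3)} {(0, 5), (1, 6), (2, 4), (3, 7)} {}"

definition half_linked_matching :: "nat \<Rightarrow> necklace_edge set" where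
  "half_linked_matching n = ring_edges n {(1, 4), (3, 5)} {(1, 6), (3, 5), (4, 7)} {0}"

definition linked_matching :: "nat \<Rightarrow> necklace_edge set" where
  "linked_matching n = ring_edges n {(4, 5)} {(4, 7), (5, 6)} {0, 1}"

lemmas ring_matching_defs = unlinked_matching_def reflected_unlinked_matching_def
  half_linked_matching_def linked_matching_def

lemma perfect_matchings_ring:
  assumes "0 < n"
  shows "perfect_matching (ring n) (unlinked_matching n)"
    "perfect_matching (ring n) (reflected_unlinked_matching n)"
    "perfect_matching (ring n) (half_linked_matching n)"
    "perfect_matching (ring n) (linked_matching n)"
  unfolding ring_matching_defs
  by (rule perfect_matching_ring[OF assms]; code_simp)+

lemma regular_three_array_ring:
  assumes "0 < n"
  shows "regular_three_array (ring n) (unlinked_matching n) (reflected_unlinked_matching n)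
    (half_linked_matching n)"
proof -
  have "unlinked_matching n \<inter> reflected_unlinked_matching n \<inter> half_linked_matching n = {}"
    using assms by (simp add: ring_matching_defs ring_edges_def necklace_edges_Int)
      (simp add: necklace_edges_def)
  then show ?thesis
    by (simp add: regular_three_array_def three_array_def perfect_matchings_ring[OF assms])
qed

lemma uncovered_linked_ring:
  assumes "0 < n"
  shows "uncovered (ring n) (unlinked_matching n) (reflected_unlinked_matching n) (linked_matching n)
    = bead_edge 0 ` {(0, 4), (1, 4), (2, 5), (3, 5)}"
proof -
  have "uncovered (ring n) (unlinked_matching n) (reflected_unlinked_matching n) (linked_matching n)
    = edges (ring n) - unlinked_matching n - reflected_unlinked_matching n - linked_matching n"
    by (auto simp: uncovered_def)
  also have "\<dots> = ring_edges n {(0, 4), (1, 4), (2, 5), (3, 5)} {} {}"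
    unfolding edges_ring ring_matching_defs ring_edges_def necklace_edges_Diff[OF assms]
    by (intro arg_cong2[of _ _ _ _ "necklace_edges n"] ext)
      (auto simp: hub_edges_def petersen_edges_def)
  also have "\<dots> = bead_edge 0 ` {(0, 4), (1, 4), (2, 5), (3, 5)}"
    by (auto simp: ring_edges_def necklace_edges_def split: if_splits)
  finally show ?thesis .
qed

lemma cut_ring:
  assumes "0 < i" "i \<le> n"
  shows "cut (ring n) ({(0, 2), (0, 3), (0, 5)} \<union> {1..<i} \<times> {..<8})
    = {bead_edge 0 (4, 5), link n i 0, link n i 1}" (is "cut _ ?S = ?C")
proof
  show "cut (ring n) ?S \<subseteq> ?C"
  proof
    fix e assume e: "e \<in> cut (ring n) ?S"
    then have "e \<in> edges (ring n)" by (simp add: cut_def)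
    then show "e \<in> ?C"
      unfolding edges_ring ring_edges_def
    proof (cases rule: necklace_edges_cases)
      case (1 j a b)
      then show ?thesis
        using e by (auto simp: cut_def ends_ring bead_edge_def hub_edges_def petersen_edges_def
            split: if_splits)
    next
      case (2 j l)
      have "fst e \<in> ?S \<longleftrightarrow> (if j = 0 then n else j - 1) < i" "snd e \<in> ?S \<longleftrightarrow> 0 < j \<and> j < i"
        using 2 assms(1) by (auto simp: link_def)
      moreover have "fst e \<in> ?S \<longleftrightarrow> snd e \<notin> ?S"
        using e by (auto simp: cut_def ends_ring)
      ultimately have "j = i" using 2 assms by (auto split: if_splits)
      then show ?thesis using 2 by auto
    qed
  qed
  have "?C \<subseteq> edges (ring n)"
    using assms
    by (auto simp: edges_ring ring_edges_def bead_edge_mem_iff link_mem_iff hub_edges_def)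
  then show "?C \<subseteq> cut (ring n) ?S"
    using assms by (auto simp: cut_def ends_ring bead_edge_def link_def)
qed

lemma hub_edge_in_perfect_matching:
  assumes "0 < i" "i \<le> n" "perfect_matching (ring n) M"
    and "link n i 0 \<in> M \<longleftrightarrow> link n i 1 \<in> M"
  shows "bead_edge 0 (4, 5) \<in> M"
proof (rule three_edge_cut_matching)
  show "cubic (ring n)" using assms by (intro cubic_ring) simp
  show "{(0, 2), (0, 3), (0, 5)} \<union> {1..<i} \<times> {..<8} \<subseteq> verts (ring n)"
    using assms by (auto simp: verts_ring)
  show "distinct [bead_edge 0 (4, 5), link n i 0, link n i 1]"
    by (simp add: link_eq_iff bead_edge_def link_def)
qed (use assms cut_ring finite_multigraph_ring in auto)

definition ring_bead :: "nat \<Rightarrow> nat \<Rightarrow> necklace_edge set" where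
  "ring_bead n i = {link n i 0, link n i 1} \<union> bead_edge i ` petersen_edges"

lemma petersen_colouring_of_covered_bead:
  assumes i: "0 < i" "i \<le> n" and array: "three_array (ring n) M1 M2 M3"
    and covered: "ring_bead n i \<subseteq> M1 \<union> M2 \<union> M3"
  shows "petersen_colouring (colour M1 M2 (link n i 0)) (colour M1 M2 (link n i 1))
    (\<lambda>e. colour M1 M2 (bead_edge i e))"
proof -
  have neq: "colour M1 M2 e \<noteq> colour M1 M2 f"
    if "e \<in> ring_bead n i" "f \<in> ring_bead n i" "e \<noteq> f" "j < 8"
      "(i, j) \<in> {fst e, snd e} \<inter> {fst f, snd f}" for e f j
  proof (rule colour_adjacent_neq[OF finite_multigraph_ring array])
    show "(i, j) \<in> verts (ring n)"
      using i \<open>j < 8\<close> by (simp add: verts_ring)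
    show "(i, j) \<in> ends (ring n) e" "(i, j) \<in> ends (ring n) f"
      using that(5) by (auto simp: ends_ring)
    show "{e, f} \<subseteq> M1 \<union> M2 \<union> M3"
      using covered that(1,2) by blast
  qed fact
  have "colour M1 M2 (bead_edge i e) \<noteq> colour M1 M2 (link n i l)"
    if "e \<in> petersen_edges" "fst e = l" "l \<in> {0, 1}" for e l
    using that by (intro neq[of _ _ l]) (auto simp: ring_bead_def bead_edge_def link_def)
  moreover have "colour M1 M2 (bead_edge i e) \<noteq> colour M1 M2 (bead_edge i f)"
    if edges: "e \<in> petersen_edges" "f \<in> petersen_edges" "e \<noteq> f"
      and meet: "{fst e, snd e} \<inter> {fst f, snd f} \<noteq> {}" for e f
  proof -
    obtain j where "j \<in> {fst e, snd e}" "j \<in> {fst f, snd f}" using meet by blast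
    moreover from this have "j < 8" using \<open>e \<in> petersen_edges\<close> by (auto simp: petersen_edges_def)
    ultimately show ?thesis
      using edges by (intro neq[of _ _ j]) (auto simp: ring_bead_def bead_edge_def prod_eq_iff)
  qed
  ultimately show ?thesis
    by (simp add: petersen_colouring_def colour_less_3)
qed

lemma links_of_covered_bead:
  assumes i: "0 < i" "i \<le> n" and array: "three_array (ring n) M1 M2 M3"
    and covered: "ring_bead n i \<subseteq> M1 \<union> M2 \<union> M3"
    and "M \<in> {M1, M2, M3}"
  shows "link n i 0 \<in> M \<longleftrightarrow> link n i 1 \<in> M"
proof -
  have same: "colour M1 M2 (link n i 0) = colour M1 M2 (link n i 1)"
    by (rule petersen_colouring_inputs_eq[OF petersen_colouring_of_covered_bead[OF i array covered]])
  have once: "covered_once M1 M2 M3 (link n i l)"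
    if "l \<in> {0, 1}" and edges: "e \<in> petersen_edges" "f \<in> petersen_edges" "e \<noteq> f"
      and l: "fst e = l" "fst f = l" for l e f
  proof (rule covered_once_at_covered_vertex[OF finite_multigraph_ring array])
    show "(i, l) \<in> verts (ring n)" using i \<open>l \<in> {0, 1}\<close> by (auto simp: verts_ring)
    show "(i, l) \<in> ends (ring n) (link n i l)" "(i, l) \<in> ends (ring n) (bead_edge i e)"
      "(i, l) \<in> ends (ring n) (bead_edge i f)"
      using l by (simp_all add: ends_ring link_def bead_edge_def)
    show "distinct [link n i l, bead_edge i e, bead_edge i f]"
      using i edges(3) by (simp add: necklace_edge_eq_iffs)
    show "{link n i l, bead_edge i e, bead_edge i f} \<subseteq> M1 \<union> M2 \<union> M3"
      using covered edges(1,2) \<open>l \<in> {0, 1}\<close> by (auto simp: ring_bead_def)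
  qed
  have "covered_once M1 M2 M3 (link n i 0)"
    by (rule once[of 0 "(0, 4)" "(0, 5)"]) (simp_all add: petersen_edges_def)
  moreover have "covered_once M1 M2 M3 (link n i 1)"
    by (rule once[of 1 "(1, 6)" "(1, 7)"]) (simp_all add: petersen_edges_def)
  ultimately show ?thesis using same \<open>M \<in> {M1, M2, M3}\<close> by (rule covered_once_same_colour)
qed

lemma regular_three_array_ring_uncovered:
  assumes i: "0 < i" "i \<le> n" and regular: "regular_three_array (ring n) M1 M2 M3"
  shows "\<exists>e\<in>uncovered (ring n) M1 M2 M3. fst (snd e) = i"
proof (rule ccontr)
  assume none: "\<not> ?thesis"
  have array: "three_array (ring n) M1 M2 M3" using regular by (simp add: regular_three_array_def)
  have "ring_bead n i \<subseteq> edges (ring n)"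
    using i by (auto simp: ring_bead_def edges_ring ring_edges_def bead_edge_mem_iff link_mem_iff)
  moreover have "fst (snd e) = i" if "e \<in> ring_bead n i" for e
    using that by (auto simp: ring_bead_def link_def bead_edge_def)
  ultimately have "ring_bead n i \<subseteq> M1 \<union> M2 \<union> M3"
    using none unfolding uncovered_def by blast
  then have "link n i 0 \<in> M \<longleftrightarrow> link n i 1 \<in> M" if "M \<in> {M1, M2, M3}" for M
    using links_of_covered_bead[OF i array _ that] by blast
  then have "bead_edge 0 (4, 5) \<in> M1 \<inter> M2 \<inter> M3"
    using hub_edge_in_perfect_matching[OF i] array by (simp add: three_array_def)
  then show False using regular by (auto simp: regular_three_array_def)
qed

lemma card_uncovered_regular_ring:
  assumes "regular_three_array (ring n) M1 M2 M3"
  shows "n \<le> card (uncovered (ring n) M1 M2 M3)" (is "_ \<le> card ?U")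
proof -
  have "i \<in> (\<lambda>e. fst (snd e)) ` ?U" if "0 < i" "i \<le> n" for i
    using regular_three_array_ring_uncovered[OF that assms] by blast
  then have "{1..n} \<subseteq> (\<lambda>e. fst (snd e)) ` ?U" by auto
  moreover have "finite ?U"
    using finite_multigraph_ring by (simp add: uncovered_def finite_multigraph_def)
  ultimately have "card {1..n} \<le> card ?U" by (intro surj_card_le)
  then show ?thesis by simp
qed

lemma defect_ring:
  assumes "4 \<le> n"
  shows "defect (ring n) = 4"
proof (rule defect_eqI[OF finite_multigraph_ring])
  have "0 < n" using assms by simp
  show "three_array (ring n) (unlinked_matching n) (reflected_unlinked_matching n) (linked_matching n)"
    by (simp add: three_array_def perfect_matchings_ring[OF \<open>0 < n\<close>])
  show "card (uncovered (ring n) (unlinked_matching n) (reflected_unlinked_matching n)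
      (linked_matching n)) = 4"
    by (simp add: uncovered_linked_ring[OF \<open>0 < n\<close>] bead_edge_def)
  fix M1 M2 M3 assume array: "three_array (ring n) M1 M2 M3"
  show "4 \<le> card (uncovered (ring n) M1 M2 M3)"
  proof (cases "M1 \<inter> M2 \<inter> M3 = {}")
    case True
    then show ?thesis
      using assms array card_uncovered_regular_ring[of n M1 M2 M3]
      by (simp add: regular_three_array_def)
  next
    case False
    then show ?thesis
      using card_uncovered_irregular[OF finite_multigraph_ring cubic_ring simple_ring array] \<open>0 < n\<close>
      by blast
  qed
qed

theorem theorem1p1:
  fixes d :: nat
  assumes "d \<ge> 4"
  shows "\<exists>G :: (nat, nat) multigraph.
    finite_multigraph G \<and> cubic G \<and> bridgeless G \<and>
    defect G = 4 \<and>
    (\<exists>M1 M2 M3. regular_three_array G M1 M2 M3) \<and> regular_defect G \<ge> d"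
proof -
  have "0 < d" using assms by simp
  define G :: "(nat, nat) multigraph" where "G = relabel to_nat to_nat (ring d)"
  have finite: "finite_multigraph G" and cubic: "cubic G"
    by (simp_all add: G_def finite_multigraph_relabel cubic_relabel finite_multigraph_ring
        cubic_ring[OF \<open>0 < d\<close>])
  obtain M1 M2 M3 where regular: "regular_three_array G M1 M2 M3"
    unfolding G_def regular_three_array_relabel[OF inj_to_nat inj_to_nat]
    using regular_three_array_ring[OF \<open>0 < d\<close>] by blast
  have "defect G = 4"
    by (simp add: G_def defect_relabel defect_ring[OF assms])
  moreover have "d \<le> regular_defect G"
    using le_regular_defectI[OF finite_multigraph_ring regular_three_array_ring[OF \<open>0 < d\<close>]]
      card_uncovered_regular_ring by (simp add: G_def regular_defect_relabel)
  ultimately show ?thesis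
    using finite cubic bridgeless_if_regular_three_array[OF finite cubic regular] regular by blast
qed

end
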